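(* Let $G_n=(V(G_n),E(G_n))$, $n\geq 1$, be random graphs with $|V(G_n)|=n$. Assume that $G_n$ converges locally in probability to $(G,o)\sim\mu$. Assume further that $$\lim_{k\to\infty}\limsup_{n\to\infty}\frac{1}{n^2}\mathbb{E}\Big[\#\big\{(x,y)\in V(G_n)\times V(G_n)\colon |\mathscr{C}(x)|\geq k,\ |\mathscr{C}(y)|\geq k,\ x\notin\mathscr{C}(y)\big\}\Big]=0.$$ Then, as $n\to\infty$, $$\frac{|\mathscr{C}_{\rm max}|}{n}\to\zeta=\mu(|\mathscr{C}(o)|=\infty)\ \text{ in probability},\qquad \frac{|\mathscr{C}_{(2)}|}{n}\to 0\ \text{ in probability}.$$
   Context: Graphs $G=(V(G),E(G))$ are locally finite. For $v\in V(G)$, $\mathscr{C}(v)$ denotes the connected component of $v$, and $|\mathscr{C}(v)|$ its number of vertices. $\mathscr{C}_{\rm max}$ and $\mathscr{C}_{(2)}$ are the largest and second largest connected components of $G_n$ (ties broken arbitrarily). Local convergence in probability: Let $\mathscr{G}_\star$ be the set of (possibly infinite) locally finite connected rooted graphs modulo rooted isomorphism $\simeq$ (a bijection of vertex sets preserving the root and adjacency). With $d_G$ the graph distance, $B_r^{(G)}(o)$ is the subgraph rooted at $o$ with vertex set $\{u\colon d_G(o,u)\leq r\}$ and all edges of $G$ between such vertices. Let $\mu$ be a probability measure on $\mathscr{G}_\star$, and let $(G,o)\sim\mu$. Then $G_n$ converges locally in probability to $(G,o)\sim\mu$ when, for every integer $r\geq 0$ and $H_\star\in\mathscr{G}_\star$,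 $\frac{1}{|V(G_n)|}\sum_{v\in V(G_n)}\mathbf{1}_{\{B_r^{(G_n)}(v)\simeq H_\star\}}$ converges in probability to $\mu(B_r^{(G)}(o)\simeq H_\star)$. *)

theory Defs
  imports "HOL-Probability.Probability"
begin

record 'a sgraph =
  verts :: "'a set"
  edges :: "'a set set"

definition simple_graph :: "'a sgraph \<Rightarrow> bool" where
  "simple_graph G \<longleftrightarrow>
     (\<forall>e\<in>edges G. \<exists>u v. u \<in> verts G \<and> v \<in> verts G \<and> u \<noteq> v \<and> e = {u, v})"

definition adj :: "'a sgraph \<Rightarrow> 'a \<Rightarrow> 'a \<Rightarrow> bool" where
  "adj G u v \<longleftrightarrow> {u, v} \<in> edges G"

definition locally_finite :: "'a sgraph \<Rightarrow> bool" where
  "locally_finite G \<longleftrightarrow> (\<forall>v\<in>verts G. finite {u. adj G v u})"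

definition cluster :: "'a sgraph \<Rightarrow> 'a \<Rightarrow> 'a set" where
  "cluster G v = {u \<in> verts G. (adj G)\<^sup>*\<^sup>* v u}"

definition clusters :: "'a sgraph \<Rightarrow> 'a set set" where
  "clusters G = cluster G ` verts G"

definition connected_graph :: "'a sgraph \<Rightarrow> bool" where
  "connected_graph G \<longleftrightarrow> (\<forall>v\<in>verts G. cluster G v = verts G)"

text \<open>The largest and second largest components; \<^const>\<open>arg_max\<close> makes an unspecified choice among
  ties. The second largest component of a connected graph is taken to be empty.\<close>

definition C_max :: "'a sgraph \<Rightarrow> 'a set" where
  "C_max G = arg_max card (\<lambda>C. C \<in> clusters G)"

definition C_second :: "'a sgraph \<Rightarrow> 'a set" where
  "C_second G = (if clusters G \<subseteq> {C_max G} then {}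
                 else arg_max card (\<lambda>C. C \<in> clusters G - {C_max G}))"

text \<open>The distance is infinite between different components.\<close>

definition graph_dist :: "'a sgraph \<Rightarrow> 'a \<Rightarrow> 'a \<Rightarrow> enat" where
  "graph_dist G u v = (INF m \<in> {m. (adj G ^^ m) u v}. enat m)"

type_synonym 'a rgraph = "'a sgraph \<times> 'a"

definition root_ball :: "nat \<Rightarrow> 'a rgraph \<Rightarrow> 'a rgraph" where
  "root_ball r = (\<lambda>(G, x).
     let B = {u \<in> verts G. graph_dist G x u \<le> enat r}
     in (\<lparr>verts = B, edges = {e \<in> edges G. e \<subseteq> B}\<rparr>, x))"

definition rooted_iso :: "'a rgraph \<Rightarrow> 'b rgraph \<Rightarrow> bool" where
  "rooted_iso = (\<lambda>(G, x) (H, y).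
     \<exists>f. bij_betw f (verts G) (verts H) \<and> f x = y \<and>
         (\<forall>u\<in>verts G. \<forall>v\<in>verts G. adj G u v \<longleftrightarrow> adj H (f u) (f v)))"

text \<open>A locally finite connected graph has countably many vertices, so all of them occur, up to
  isomorphism, with vertex set contained in \<^typ>\<open>nat\<close>. An element of \<open>G_star\<close> is an
  isomorphism class of such graphs on natural numbers; \<open>iso_class\<close> maps a rooted graph over
  any vertex type to its class.\<close>

definition rooted_graphs :: "'a rgraph set" where
  "rooted_graphs = {(G, x). simple_graph G \<and> locally_finite G \<and> connected_graph G \<and> x \<in> verts G}"

definition iso_class :: "'a rgraph \<Rightarrow> nat rgraph set" where
  "iso_class g = {h \<in> rooted_graphs. rooted_iso g h}"

lemma rooted_iso_refl: "rooted_iso g g"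
  unfolding rooted_iso_def by (auto intro!: exI[of _ "\<lambda>x. x"] bij_betw_id[unfolded id_def])

lemma rooted_iso_trans:
  assumes "rooted_iso g h" "rooted_iso h k"
  shows "rooted_iso g k"
proof -
  obtain G x H y K z where e: "g = (G, x)" "h = (H, y)" "k = (K, z)"
    by (metis surj_pair)
  from assms obtain f f' where
    f: "bij_betw f (verts G) (verts H)" "f x = y"
       "\<forall>u\<in>verts G. \<forall>v\<in>verts G. adj G u v \<longleftrightarrow> adj H (f u) (f v)" and
    f': "bij_betw f' (verts H) (verts K)" "f' y = z"
       "\<forall>u\<in>verts H. \<forall>v\<in>verts H. adj H u v \<longleftrightarrow> adj K (f' u) (f' v)"
    unfolding rooted_iso_def e by auto
  have "bij_betw (f' \<circ> f) (verts G) (verts K)"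
    using f(1) f'(1) by (rule bij_betw_trans)
  then show ?thesis
    unfolding rooted_iso_def e using f f'
    by (auto intro!: exI[of _ "f' \<circ> f"] dest: bij_betwE)
qed

lemma rooted_iso_sym:
  assumes "rooted_iso g h" "snd g \<in> verts (fst g)"
  shows "rooted_iso h g"
proof -
  obtain G x H y where e: "g = (G, x)" "h = (H, y)"
    by (metis surj_pair)
  from assms obtain f where
    f: "bij_betw f (verts G) (verts H)" "f x = y"
       "\<forall>u\<in>verts G. \<forall>v\<in>verts G. adj G u v \<longleftrightarrow> adj H (f u) (f v)" and x: "x \<in> verts G"
    unfolding rooted_iso_def e by auto
  let ?f = "the_inv_into (verts G) f"
  have inj: "inj_on f (verts G)" and im: "f ` verts G = verts H"
    using f(1) by (auto simp: bij_betw_def)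
  have "bij_betw ?f (verts H) (verts G)"
    using f(1) by (rule bij_betw_the_inv_into)
  moreover have "?f y = x"
    using f(2) inj x by (auto simp: the_inv_into_f_f)
  moreover have "\<forall>u\<in>verts H. \<forall>v\<in>verts H. adj H u v \<longleftrightarrow> adj G (?f u) (?f v)"
    using f(3) inj by (auto simp: the_inv_into_f_f im[symmetric])
  ultimately show ?thesis
    unfolding rooted_iso_def e by auto
qed

lemma iso_class_eq_iff:
  fixes g :: "'a rgraph" and h :: "nat rgraph"
  assumes "g \<in> rooted_graphs" "h \<in> rooted_graphs"
  shows "iso_class g = iso_class h \<longleftrightarrow> rooted_iso g h"
proof
  assume "iso_class g = iso_class h"
  then show "rooted_iso g h"
    using assms rooted_iso_refl[of h] by (auto simp: iso_class_def)
next
  assume gh: "rooted_iso g h"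
  have "snd g \<in> verts (fst g)"
    using assms by (auto simp: rooted_graphs_def)
  then have "rooted_iso h g"
    using gh rooted_iso_sym by blast
  then show "iso_class g = iso_class h"
    using gh by (auto simp: iso_class_def intro: rooted_iso_trans)
qed

definition G_star :: "nat rgraph set set" where
  "G_star = iso_class ` (rooted_graphs :: nat rgraph set)"

definition ball_event :: "nat \<Rightarrow> nat rgraph set \<Rightarrow> nat rgraph set set" where
  "ball_event r H = iso_class ` {g \<in> (rooted_graphs :: nat rgraph set). iso_class (root_ball r g) = H}"

definition infinite_event :: "nat rgraph set set" where
  "infinite_event = iso_class ` {(G, x) \<in> (rooted_graphs :: nat rgraph set). infinite (cluster G x)}"

text \<open>The events \<open>ball_event r H\<close> are the balls of the local metric, which is separable;
  hence they generate its Borel sigma-algebra.\<close>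

definition G_star_space :: "nat rgraph set measure" where
  "G_star_space = sigma G_star {ball_event r H | r H. H \<in> G_star}"

definition graphs_of_size :: "nat \<Rightarrow> 'a sgraph set" where
  "graphs_of_size n = {G. simple_graph G \<and> finite (verts G) \<and> card (verts G) = n}"

text \<open>The variables \<open>X n\<close> may live on different probability spaces \<open>P n\<close>.\<close>

definition conv_in_prob :: "(nat \<Rightarrow> 'w measure) \<Rightarrow> (nat \<Rightarrow> 'w \<Rightarrow> real) \<Rightarrow> real \<Rightarrow> bool" where
  "conv_in_prob P X c \<longleftrightarrow>
     (\<forall>\<epsilon>>0. (\<lambda>n. measure (P n) {\<omega> \<in> space (P n). \<bar>X n \<omega> - c\<bar> > \<epsilon>}) \<longlonglongrightarrow> 0)"

definition local_conv_in_prob ::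
  "(nat \<Rightarrow> 'w measure) \<Rightarrow> (nat \<Rightarrow> 'w \<Rightarrow> 'a sgraph) \<Rightarrow> nat rgraph set measure \<Rightarrow> bool" where
  "local_conv_in_prob P G \<mu> \<longleftrightarrow>
     (\<forall>r. \<forall>H\<in>G_star.
        conv_in_prob P
          (\<lambda>n \<omega>. 1 / real (card (verts (G n \<omega>))) *
             (\<Sum>v\<in>verts (G n \<omega>). of_bool (iso_class (root_ball r (G n \<omega>, v)) = H)))
          (measure \<mu> (ball_event r H)))"

definition separated_pairs :: "nat \<Rightarrow> 'a sgraph \<Rightarrow> ('a \<times> 'a) set" where
  "separated_pairs k G =
     {(x, y) \<in> verts G \<times> verts G.
        card (cluster G x) \<ge> k \<and> card (cluster G y) \<ge> k \<and> x \<notin> cluster G y}"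

end

theory Submission
  imports Defs
begin

text \<open>Write \<open>S\<close> for the number of vertices whose component has at least \<open>k\<close> vertices, and
  \<open>N\<close> for the number of separated pairs of such vertices. The proof compares both
  largest components with \<open>S\<close>, up to errors that vanish as first \<open>n\<close> and then \<open>k\<close> tend to
  infinity.

  On every finite nonempty graph, \<open>\<bar>C_max\<bar> \<le> k + S\<close>, since a component with at least \<open>k\<close> vertices
  consists of vertices counted by \<open>S\<close> (\<open>card_C_max_le\<close>). Conversely, each of the \<open>S\<close> vertices is
  separated from at least \<open>S - \<bar>C_max\<bar>\<close> others, so \<open>S - \<bar>C_max\<bar> \<le> sqrt N\<close>
  (\<open>card_big_verts_le\<close>). If the second component has at least \<open>k\<close> vertices, all pairs in
  \<open>C_max \<times> C_second\<close> are separated, so that \<open>\<bar>C_second\<bar> \<le> k + sqrt N\<close> in any case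
  (\<open>card_C_second_le\<close>).

  Having a component with fewer than \<open>k\<close> vertices is a local property: it says that the ball of
  radius \<open>k\<close> belongs to one of the finitely many isomorphism classes in \<open>small_classes k\<close>. Local
  convergence, summed over these classes, gives \<open>S / n \<rightarrow> \<mu> (\<bar>C(o)\<bar> \<ge> k)\<close> in probability
  (\<open>big_verts_conv_in_prob\<close>), and this limit tends to \<open>\<mu> (\<bar>C(o)\<bar> = \<infinity>)\<close> as \<open>k \<rightarrow> \<infinity>\<close> by
  continuity of measures (\<open>measure_small_classes_tendsto\<close>). Finally Markov's inequality turns the
  hypothesis on the expectation of \<open>N\<close> into a bound on the probability that \<open>sqrt N\<close> is of
  order \<open>n\<close> (\<open>separated_pairs_Markov\<close>).\<close>

section \<open>Components and balls\<close>

lemma adj_commute: "adj G u v \<longleftrightarrow> adj G v u"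
  by (simp add: adj_def insert_commute)

lemma adj_in_verts:
  assumes "simple_graph G" "adj G u v"
  shows "u \<in> verts G" "v \<in> verts G"
  using assms by (auto simp: simple_graph_def adj_def doubleton_eq_iff)

lemma rtranclp_adj_commute: "(adj G)\<^sup>*\<^sup>* u v \<Longrightarrow> (adj G)\<^sup>*\<^sup>* v u"
  by (induction rule: rtranclp_induct) (blast intro: converse_rtranclp_into_rtranclp adj_commute[THEN iffD1])+

lemma cluster_refl: "v \<in> verts G \<Longrightarrow> v \<in> cluster G v"
  by (simp add: cluster_def)

lemma cluster_subset_verts: "cluster G v \<subseteq> verts G"
  by (auto simp: cluster_def)

lemma cluster_eq: "u \<in> cluster G v \<Longrightarrow> cluster G u = cluster G v"
  unfolding cluster_def by (blast intro: rtranclp_trans rtranclp_adj_commute)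

definition near :: "'a sgraph \<Rightarrow> nat \<Rightarrow> 'a \<Rightarrow> 'a set" where
  "near G r x = {u \<in> verts G. \<exists>m\<le>r. (adj G ^^ m) x u}"

lemma graph_dist_le_iff: "graph_dist G x u \<le> enat r \<longleftrightarrow> (\<exists>m\<le>r. (adj G ^^ m) x u)"
proof
  assume "graph_dist G x u \<le> enat r"
  then have "graph_dist G x u < enat (Suc r)"
    using le_less_trans by fastforce
  then show "\<exists>m\<le>r. (adj G ^^ m) x u"
    by (auto simp: graph_dist_def INF_less_iff less_Suc_eq_le)
next
  assume "\<exists>m\<le>r. (adj G ^^ m) x u"
  then show "graph_dist G x u \<le> enat r"
    unfolding graph_dist_def by (metis (mono_tags) INF_lower2 enat_ord_simps(1) mem_Collect_eq)
qed

lemma root_ball_eq: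
  "root_ball r (G, x) = (\<lparr>verts = near G r x, edges = {e \<in> edges G. e \<subseteq> near G r x}\<rparr>, x)"
  by (simp add: root_ball_def near_def graph_dist_le_iff Let_def)

lemma near_refl: "x \<in> verts G \<Longrightarrow> x \<in> near G r x"
  by (auto simp: near_def intro!: exI[of _ 0])

lemma near_mono: "r \<le> s \<Longrightarrow> near G r x \<subseteq> near G s x"
  unfolding near_def using order_trans by blast

lemma near_subset_cluster: "near G r x \<subseteq> cluster G x"
  by (auto simp: near_def cluster_def rtranclp_power)

lemma near_Suc: "u \<in> near G r x \<Longrightarrow> adj G u v \<Longrightarrow> v \<in> verts G \<Longrightarrow> v \<in> near G (Suc r) x"
proof -
  assume "u \<in> near G r x" "adj G u v" "v \<in> verts G"
  then obtain m where "m \<le> r" "(adj G ^^ m) x u" by (auto simp: near_def)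
  then have "Suc m \<le> Suc r" "(adj G ^^ Suc m) x v" using \<open>adj G u v\<close> by auto
  then show ?thesis using \<open>v \<in> verts G\<close> unfolding near_def by blast
qed

text \<open>A ball that its next layer does not enlarge is closed under adjacency.\<close>

lemma near_stable_imp_cluster:
  assumes G: "simple_graph G" and x: "x \<in> verts G" and st: "near G (Suc r) x \<subseteq> near G r x"
  shows "near G r x = cluster G x"
proof -
  have "u \<in> near G r x" if "(adj G)\<^sup>*\<^sup>* x u" for u
    using that
  proof (induction rule: rtranclp_induct)
    case base
    show ?case using x by (rule near_refl)
  next
    case (step y z)
    then show ?case using near_Suc[OF step.IH step.hyps(2) adj_in_verts(2)[OF G step.hyps(2)]] st by blast
  qed
  then show ?thesis
    using near_subset_cluster[of G r x] by (auto simp: cluster_def)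
qed

text \<open>Going outwards from the root, the successive balls gain a vertex at each step until they
  fill the component. Hence a ball with fewer vertices than its radius is the whole component.\<close>

lemma small_near_eq_cluster:
  assumes G: "simple_graph G" and x: "x \<in> verts G"
    and fin: "finite (near G k x)" and card: "card (near G k x) < k"
  shows "near G k x = cluster G x"
proof -
  have "\<exists>j<k. near G (Suc j) x \<subseteq> near G j x"
  proof (rule ccontr)
    assume no: "\<not> ?thesis"
    have "j \<le> card (near G j x)" if "j \<le> k" for j
      using that
    proof (induction j)
      case (Suc j)
      have "\<not> near G (Suc j) x \<subseteq> near G j x" using no Suc.prems by simp
      then have "near G j x \<subset> near G (Suc j) x"
        by (simp add: less_le_not_le near_mono)
      moreover have "finite (near G (Suc j) x)"
        using fin near_mono[OF Suc.prems] by (rule rev_finite_subset)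
      ultimately have "card (near G j x) < card (near G (Suc j) x)"
        by (intro psubset_card_mono)
      then show ?case using Suc by simp
    qed simp
    then show False using card by fastforce
  qed
  then obtain j where "j < k" "near G (Suc j) x \<subseteq> near G j x" by blast
  then have "cluster G x \<subseteq> near G k x"
    using near_stable_imp_cluster[OF G x] near_mono[of j k G x] by auto
  then show ?thesis using near_subset_cluster[of G k x] by blast
qed

lemma small_near_iff_small_cluster:
  assumes "simple_graph G" "x \<in> verts G"
  shows "finite (near G k x) \<and> card (near G k x) < k \<longleftrightarrow>
         finite (cluster G x) \<and> card (cluster G x) < k"
proof
  assume "finite (near G k x) \<and> card (near G k x) < k"
  then show "finite (cluster G x) \<and> card (cluster G x) < k"
    using small_near_eq_cluster[OF assms, of k] by auto
next
  assume *: "finite (cluster G x) \<and> card (cluster G x) < k"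
  then show "finite (near G k x) \<and> card (near G k x) < k"
    using card_mono[OF _ near_subset_cluster[of G k x]] finite_subset[OF near_subset_cluster[of G k x]]
    by linarith
qed

text \<open>Connectedness is the point: a walk of length at most \<open>r\<close> from the root does not leave
  the ball, so it survives the passage to the induced subgraph.\<close>

lemma root_ball_in_rooted_graphs:
  assumes G: "simple_graph G" "locally_finite G" and x: "x \<in> verts G"
  shows "root_ball r (G, x) \<in> rooted_graphs"
proof -
  define B where "B = \<lparr>verts = near G r x, edges = {e \<in> edges G. e \<subseteq> near G r x}\<rparr>"
  have adjB: "adj B u v \<longleftrightarrow> adj G u v \<and> u \<in> near G r x \<and> v \<in> near G r x" for u v
    by (auto simp: adj_def B_def)
  have vB: "verts B = near G r x" by (simp add: B_def)
  have "simple_graph B"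
    unfolding simple_graph_def
  proof
    fix e assume "e \<in> edges B"
    then have e: "e \<in> edges G" "e \<subseteq> near G r x" by (auto simp: B_def)
    then obtain u v where "u \<noteq> v" "e = {u, v}" using G(1) by (auto simp: simple_graph_def)
    then show "\<exists>u v. u \<in> verts B \<and> v \<in> verts B \<and> u \<noteq> v \<and> e = {u, v}"
      using e vB by auto
  qed
  moreover have "locally_finite B"
    unfolding locally_finite_def
  proof
    fix v assume "v \<in> verts B"
    then have "finite {u. adj G v u}"
      using G(2) by (auto simp: locally_finite_def vB near_def)
    then show "finite {u. adj B v u}" by (rule rev_finite_subset) (auto simp: adjB)
  qed
  moreover have reach: "(adj B)\<^sup>*\<^sup>* x u" if "(adj G ^^ m) x u" "m \<le> r" for m u
    using that
  proof (induction m arbitrary: u)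
    case (Suc m)
    then obtain y where y: "(adj G ^^ m) x y" "adj G y u" by auto
    have "m \<le> r" using Suc.prems by simp
    then have "y \<in> near G r x" "u \<in> near G r x"
      using Suc.prems y(1) adj_in_verts[OF G(1) y(2)] unfolding near_def by blast+
    then have "adj B y u" using y by (simp add: adjB)
    then show ?case using Suc y by (meson Suc_leD rtranclp.rtrancl_into_rtrancl)
  qed simp
  have "connected_graph B"
    unfolding connected_graph_def
  proof
    fix v assume "v \<in> verts B"
    then have v: "(adj B)\<^sup>*\<^sup>* v x"
      using reach rtranclp_adj_commute[of B x v] by (auto simp: vB near_def)
    have "(adj B)\<^sup>*\<^sup>* v u" if "u \<in> verts B" for u
      using that reach v by (auto simp: vB near_def intro: rtranclp_trans)
    then show "cluster B v = verts B" by (auto simp: cluster_def)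
  qed
  ultimately show ?thesis
    using near_refl[OF x] by (simp add: root_ball_eq rooted_graphs_def flip: B_def) (simp add: vB)
qed

section \<open>Isomorphism classes of small graphs\<close>

lemma iso_class_cong:
  assumes "rooted_iso g h" "snd g \<in> verts (fst g)"
  shows "iso_class g = iso_class h"
  using rooted_iso_trans[OF assms(1)] rooted_iso_trans[OF rooted_iso_sym[OF assms]]
  unfolding iso_class_def by blast

lemma rooted_iso_finite_card:
  assumes "rooted_iso g h"
  shows "finite (verts (fst g)) \<longleftrightarrow> finite (verts (fst h))"
    and "card (verts (fst g)) = card (verts (fst h))"
  using assms by (auto simp: rooted_iso_def bij_betw_finite bij_betw_same_card split: prod.splits)

text \<open>This normal form serves two ends: it makes the class \<open>iso_class g\<close> nonempty when the vertices
  of \<open>g\<close> are not natural numbers, and it leaves only finitely many graphs of bounded size.\<close>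

lemma finite_rooted_graph_representative:
  fixes g :: "'a rgraph"
  assumes g: "g \<in> rooted_graphs" and fin: "finite (verts (fst g))"
  defines "m \<equiv> card (verts (fst g))"
  shows "\<exists>E y. E \<subseteq> Pow {..<m} \<and> y < m \<and> (\<lparr>verts = {..<m}, edges = E\<rparr>, y) \<in> rooted_graphs \<and>
           rooted_iso g (\<lparr>verts = {..<m}, edges = E\<rparr>, y)"
proof -
  obtain G x where gx: "g = (G, x)" by (rule prod.exhaust)
  have G: "simple_graph G" "connected_graph G" and x: "x \<in> verts G"
    using g by (auto simp: rooted_graphs_def gx)
  obtain f where f: "bij_betw f (verts G) {..<m}"
    using fin ex_bij_betw_finite_nat[of "verts G"] by (auto simp: gx m_def lessThan_atLeast0)
  then have inj: "inj_on f (verts G)" and im: "f ` verts G = {..<m}"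
    by (auto simp: bij_betw_def)
  define K where "K = \<lparr>verts = {..<m}, edges = (\<lambda>e. f ` e) ` edges G\<rparr>"
  have eV: "e \<subseteq> verts G" if "e \<in> edges G" for e
    using that G(1) by (auto simp: simple_graph_def)
  have vK: "verts K = {..<m}" by (simp add: K_def)
  have adjK: "adj K (f u) (f v) \<longleftrightarrow> adj G u v" if "u \<in> verts G" "v \<in> verts G" for u v
  proof
    assume "adj K (f u) (f v)"
    then obtain e where e: "e \<in> edges G" "f ` e = f ` {u, v}"
      by (auto simp: adj_def K_def)
    then have "e = {u, v}"
      using inj_on_image_eq_iff[OF inj eV, of e "{u, v}"] that by simp
    then show "adj G u v" using e by (simp add: adj_def)
  next
    assume "adj G u v"
    then have "f ` {u, v} \<in> edges K"
      unfolding adj_def K_def sgraph.simps by (rule imageI)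
    then show "adj K (f u) (f v)" by (simp add: adj_def)
  qed
  have sK: "simple_graph K"
    unfolding simple_graph_def
  proof
    fix e assume "e \<in> edges K"
    then obtain e' where e': "e' \<in> edges G" "e = f ` e'" by (auto simp: K_def)
    then obtain u v where uv: "u \<in> verts G" "v \<in> verts G" "u \<noteq> v" "e' = {u, v}"
      using G(1) unfolding simple_graph_def by blast
    then have "f u \<noteq> f v" using inj by (auto dest: inj_onD)
    moreover have "f u \<in> verts K" "f v \<in> verts K" using uv im vK by auto
    moreover have "e = {f u, f v}" using e' uv by auto
    ultimately show "\<exists>u v. u \<in> verts K \<and> v \<in> verts K \<and> u \<noteq> v \<and> e = {u, v}" by blast
  qed
  have "locally_finite K"
    unfolding locally_finite_def
  proof
    fix v
    have "{u. adj K v u} \<subseteq> {..<m}" using adj_in_verts(2)[OF sK] vK by blast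
    then show "finite {u. adj K v u}" by (rule finite_subset) simp
  qed
  moreover have "connected_graph K"
    unfolding connected_graph_def
  proof
    fix v assume "v \<in> verts K"
    then obtain a where a: "a \<in> verts G" "v = f a" using im vK by auto
    have path: "(adj K)\<^sup>*\<^sup>* (f a) (f b)" if "(adj G)\<^sup>*\<^sup>* a b" for b
      using that
    proof (induction rule: rtranclp_induct)
      case (step y z)
      then have "adj K (f y) (f z)" using adjK adj_in_verts[OF G(1)] by blast
      then show ?case using step by simp
    qed simp
    have "(adj K)\<^sup>*\<^sup>* v u" if "u \<in> verts K" for u
    proof -
      obtain b where b: "b \<in> verts G" "u = f b" using \<open>u \<in> verts K\<close> im vK by auto
      then have "b \<in> cluster G a" using G(2) a by (auto simp: connected_graph_def)
      then show ?thesis using path b a by (auto simp: cluster_def)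
    qed
    then show "cluster K v = verts K" by (auto simp: cluster_def)
  qed
  moreover have "f x < m" using im x by auto
  moreover have "rooted_iso g (K, f x)"
    unfolding rooted_iso_def gx using f adjK vK by (auto intro!: exI[of _ f])
  moreover have "edges K \<subseteq> Pow {..<m}" using eV im by (auto simp: K_def)
  ultimately show ?thesis
    using sK vK by (intro exI[of _ "edges K"] exI[of _ "f x"])
      (auto simp: rooted_graphs_def K_def)
qed

definition small_classes :: "nat \<Rightarrow> nat rgraph set set" where
  "small_classes k =
     iso_class ` {h \<in> (rooted_graphs :: nat rgraph set).
       finite (verts (fst h)) \<and> card (verts (fst h)) < k}"

lemma small_classes_subset_G_star: "small_classes k \<subseteq> G_star"
  by (auto simp: small_classes_def G_star_def)

lemma finite_small_classes: "finite (small_classes k)"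
proof -
  let ?g = "\<lambda>(m, E, y). iso_class (\<lparr>verts = {..<m}, edges = E\<rparr> :: nat sgraph, y)"
  have "small_classes k \<subseteq> ?g ` ({..<k} \<times> Pow (Pow {..<k}) \<times> {..<k})"
  proof
    fix H assume "H \<in> small_classes k"
    then obtain h :: "nat rgraph" where h: "h \<in> rooted_graphs" "finite (verts (fst h))"
      "card (verts (fst h)) < k" "H = iso_class h"
      by (auto simp: small_classes_def)
    define m where "m = card (verts (fst h))"
    obtain E y where E: "E \<subseteq> Pow {..<m}" "y < m"
      "rooted_iso h (\<lparr>verts = {..<m}, edges = E\<rparr> :: nat sgraph, y)"
      using finite_rooted_graph_representative[OF h(1,2)] unfolding m_def by blast
    have "snd h \<in> verts (fst h)" using h(1) by (auto simp: rooted_graphs_def)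
    then have "H = ?g (m, E, y)" using iso_class_cong[OF E(3)] h(4) by simp
    moreover have "(m, E, y) \<in> {..<k} \<times> Pow (Pow {..<k}) \<times> {..<k}"
      using E h(3) by (fastforce simp: m_def[symmetric])
    ultimately show "H \<in> ?g ` ({..<k} \<times> Pow (Pow {..<k}) \<times> {..<k})" by blast
  qed
  then show ?thesis by (rule finite_subset) auto
qed

text \<open>The finiteness condition cannot be dropped on the right-hand side, since \<^const>\<open>card\<close>
  vanishes on infinite sets.\<close>

lemma iso_class_in_small_classes_iff:
  fixes g :: "'a rgraph"
  assumes g: "g \<in> rooted_graphs"
  shows "iso_class g \<in> small_classes k \<longleftrightarrow> finite (verts (fst g)) \<and> card (verts (fst g)) < k"
proof
  assume "iso_class g \<in> small_classes k"
  then obtain h :: "nat rgraph" where h: "h \<in> rooted_graphs" "finite (verts (fst h))"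
      "card (verts (fst h)) < k" "iso_class g = iso_class h"
    by (auto simp: small_classes_def)
  then have "rooted_iso g h" using iso_class_eq_iff[OF g h(1)] by simp
  then show "finite (verts (fst g)) \<and> card (verts (fst g)) < k"
    using h rooted_iso_finite_card by metis
next
  assume *: "finite (verts (fst g)) \<and> card (verts (fst g)) < k"
  then obtain h :: "nat rgraph" where h: "h \<in> rooted_graphs" "rooted_iso g h"
    using finite_rooted_graph_representative[OF g] by blast
  then have "iso_class g = iso_class h" using iso_class_eq_iff[OF g h(1)] by simp
  then show "iso_class g \<in> small_classes k"
    using h * rooted_iso_finite_card[OF h(2)] by (auto simp: small_classes_def)
qed

lemma root_ball_in_small_classes_iff:
  assumes "simple_graph G" "locally_finite G" "x \<in> verts G"
  shows "iso_class (root_ball k (G, x)) \<in> small_classes k \<longleftrightarrow>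
         finite (cluster G x) \<and> card (cluster G x) < k"
proof -
  have "iso_class (root_ball k (G, x)) \<in> small_classes k \<longleftrightarrow> finite (near G k x) \<and> card (near G k x) < k"
    using iso_class_in_small_classes_iff[OF root_ball_in_rooted_graphs[OF assms], of k k]
    unfolding root_ball_eq fst_conv sgraph.simps .
  then show ?thesis
    unfolding small_near_iff_small_cluster[OF assms(1,3)] .
qed

lemma root_ball_small_eq:
  assumes g: "(G, x) \<in> rooted_graphs" and "finite (verts G)" "card (verts G) < k"
  shows "root_ball k (G, x) = (G, x)"
proof -
  have G: "simple_graph G" "x \<in> verts G" and c: "cluster G x = verts G"
    using g unfolding rooted_graphs_def connected_graph_def by blast+
  have "finite (near G k x) \<and> card (near G k x) < k"
    unfolding small_near_iff_small_cluster[OF G] using assms(2,3) c by simp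
  then have "near G k x = verts G"
    using small_near_eq_cluster[OF G] c by blast
  moreover have "{e \<in> edges G. e \<subseteq> verts G} = edges G"
    using G(1) by (auto simp: simple_graph_def)
  ultimately show ?thesis by (simp add: root_ball_eq)
qed

text \<open>A connected graph whose ball of radius \<open>k\<close> has fewer than \<open>k\<close> vertices equals that ball, so the
  event that the ball is a prescribed small graph contains only that graph.\<close>

lemma ball_event_small:
  assumes H: "H \<in> small_classes k"
  shows "ball_event k H = {H}"
proof -
  have *: "iso_class g = H" if g: "g \<in> rooted_graphs" and b: "iso_class (root_ball k g) = H"
    for g :: "nat rgraph"
  proof -
    obtain G x where gx: "g = (G, x)" by (rule prod.exhaust)
    have G: "simple_graph G" "locally_finite G" "x \<in> verts G" and c: "cluster G x = verts G"
      using g unfolding rooted_graphs_def connected_graph_def gx by blast+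
    have "iso_class (root_ball k (G, x)) \<in> small_classes k"
      using b H gx by simp
    then have "finite (verts G)" "card (verts G) < k"
      unfolding root_ball_in_small_classes_iff[OF G] c by blast+
    then have "root_ball k g = g"
      using root_ball_small_eq[of G x k] g gx by simp
    then show ?thesis using b by simp
  qed
  obtain h :: "nat rgraph" where h: "h \<in> rooted_graphs" "finite (verts (fst h))"
      "card (verts (fst h)) < k" "H = iso_class h"
    using H unfolding small_classes_def by blast
  have "root_ball k h = h"
    using root_ball_small_eq[of "fst h" "snd h" k] h by simp
  then have "H \<in> ball_event k H"
    unfolding ball_event_def by (intro image_eqI[where x = h]) (simp_all add: h(1,4))
  moreover have "ball_event k H \<subseteq> {H}"
    unfolding ball_event_def using * by (simp add: image_subset_iff)
  ultimately show ?thesis by (simp add: set_eq_subset)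
qed

text \<open>Infinitude of the component is thereby expressed through countably many one-point sets that
  are ball events; this is what makes it measurable.\<close>

lemma infinite_event_eq: "infinite_event = G_star - (\<Union>k. small_classes k)"
proof -
  have *: "infinite (cluster (fst g) (snd g)) \<longleftrightarrow> (\<forall>k. iso_class g \<notin> small_classes k)"
    if g: "g \<in> rooted_graphs" for g :: "nat rgraph"
  proof -
    have "cluster (fst g) (snd g) = verts (fst g)"
      using g unfolding rooted_graphs_def connected_graph_def by auto
    then show ?thesis
      unfolding iso_class_in_small_classes_iff[OF g] by auto
  qed
  show ?thesis
    unfolding infinite_event_def G_star_def using * by fastforce
qed

lemma incseq_small_classes: "incseq small_classes"
  by (fastforce simp: incseq_def small_classes_def)

lemma space_G_star_space: "space G_star_space = G_star"
  and ball_event_sets: "H \<in> G_star \<Longrightarrow> ball_event r H \<in> sets G_star_space"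
proof -
  have sub: "{ball_event r H |r H. H \<in> G_star} \<subseteq> Pow G_star"
    by (auto simp: ball_event_def G_star_def)
  show "space G_star_space = G_star"
    unfolding G_star_space_def using sub by (rule space_measure_of)
  show "ball_event r H \<in> sets G_star_space" if "H \<in> G_star"
    unfolding G_star_space_def sets_measure_of[OF sub] using that by (intro sigma_sets.Basic) auto
qed

lemma
  assumes "prob_space \<mu>" and S: "sets \<mu> = sets G_star_space"
  shows measure_small_classes:
      "measure \<mu> (small_classes k) = (\<Sum>H\<in>small_classes k. measure \<mu> (ball_event k H))"
    and measure_small_classes_tendsto:
      "(\<lambda>k. measure \<mu> (small_classes k)) \<longlonglongrightarrow> 1 - measure \<mu> infinite_event"
proof -
  interpret prob_space \<mu> by fact
  have single: "{H} \<in> sets \<mu>" if "H \<in> small_classes k" for H k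
    using ball_event_sets[of H k] ball_event_small[OF that] small_classes_subset_G_star[of k] that S
    by auto
  show "measure \<mu> (small_classes k) = (\<Sum>H\<in>small_classes k. measure \<mu> (ball_event k H))"
    using finite_measure_eq_sum_singleton[OF finite_small_classes single, of k]
    by (simp add: ball_event_small)
  have meas: "small_classes k \<in> sets \<mu>" for k
    by (rule sets.countable[OF single countable_finite[OF finite_small_classes]])
  then have r: "range small_classes \<subseteq> sets \<mu>" by blast
  have "space \<mu> = G_star" using S space_G_star_space by (metis sets_eq_imp_space_eq)
  then have "measure \<mu> infinite_event = 1 - measure \<mu> (\<Union>k. small_classes k)"
    using prob_compl[of "\<Union>k. small_classes k"] r by (simp add: infinite_event_eq sets.countable_UN)
  then show "(\<lambda>k. measure \<mu> (small_classes k)) \<longlonglongrightarrow> 1 - measure \<mu> infinite_event"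
    using finite_Lim_measure_incseq[OF r incseq_small_classes] by simp
qed

section \<open>Counting pairs in a finite graph\<close>

definition big_verts :: "nat \<Rightarrow> 'a sgraph \<Rightarrow> 'a set" where
  "big_verts k G = {v \<in> verts G. k \<le> card (cluster G v)}"

lemma card_clusters_less:
  assumes "finite (verts G)" "C \<in> clusters G"
  shows "card C < Suc (card (verts G))"
proof -
  obtain v where "C = cluster G v" using assms(2) unfolding clusters_def by blast
  then show ?thesis
    using card_mono[OF assms(1) cluster_subset_verts[of G v]] by simp
qed

lemma
  assumes "finite (verts G)" "verts G \<noteq> {}"
  shows C_max_in_clusters: "C_max G \<in> clusters G"
    and card_le_C_max: "C \<in> clusters G \<Longrightarrow> card C \<le> card (C_max G)"
proof -
  obtain D where D: "D \<in> clusters G" using assms(2) unfolding clusters_def by blast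
  have *: "C_max G \<in> clusters G \<and> (\<forall>C. C \<in> clusters G \<longrightarrow> card C \<le> card (C_max G))"
    unfolding C_max_def
    by (rule arg_max_nat_lemma[where P = "\<lambda>C. C \<in> clusters G", OF D])
      (blast intro: card_clusters_less[OF assms(1)])
  show "C_max G \<in> clusters G" using * by simp
  show "card C \<le> card (C_max G)" if "C \<in> clusters G" using * that by simp
qed

lemma C_second_in_clusters:
  assumes fin: "finite (verts G)" and ne: "C_second G \<noteq> {}"
  shows "C_second G \<in> clusters G - {C_max G}"
proof -
  have n: "\<not> clusters G \<subseteq> {C_max G}" using ne by (auto simp: C_second_def)
  then obtain C where C: "C \<in> clusters G - {C_max G}" by blast
  have "arg_max card (\<lambda>C. C \<in> clusters G - {C_max G}) \<in> clusters G - {C_max G}"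
    by (rule arg_max_natI[where P = "\<lambda>C. C \<in> clusters G - {C_max G}", OF C])
      (blast intro: card_clusters_less[OF fin])
  then show ?thesis using n by (simp add: C_second_def)
qed

lemma clusters_cluster_eq: "C \<in> clusters G \<Longrightarrow> x \<in> C \<Longrightarrow> x \<in> verts G \<and> cluster G x = C"
  using cluster_eq cluster_subset_verts by (fastforce simp: clusters_def)

lemma separated_pairs_subset: "separated_pairs k G \<subseteq> verts G \<times> verts G"
  by (auto simp: separated_pairs_def)

lemma finite_separated_pairs: "finite (verts G) \<Longrightarrow> finite (separated_pairs k G)"
  by (rule finite_subset[OF separated_pairs_subset]) simp

text \<open>If the largest component has at least \<open>k\<close> vertices, it consists of vertices in components of
  that size; otherwise the summand \<open>k\<close> covers it.\<close>

lemma card_C_max_le: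
  assumes "finite (verts G)" "verts G \<noteq> {}"
  shows "card (C_max G) \<le> k + card (big_verts k G)"
proof (cases "k \<le> card (C_max G)")
  case True
  have "C_max G \<subseteq> big_verts k G"
    using clusters_cluster_eq[OF C_max_in_clusters[OF assms]] True by (auto simp: big_verts_def)
  then show ?thesis
    using assms(1) card_mono[of "big_verts k G" "C_max G"] by (simp add: big_verts_def)
qed simp

text \<open>Each vertex in a large component is separated from all such vertices outside its own
  component, and the latter has at most \<open>card (C_max G)\<close> elements.\<close>

lemma card_big_verts_le:
  assumes fin: "finite (verts G)" and ne: "verts G \<noteq> {}"
  shows "real (card (big_verts k G)) \<le> real (card (C_max G)) + sqrt (real (card (separated_pairs k G)))"
proof (cases "card (C_max G) \<le> card (big_verts k G)")
  case True
  let ?B = "big_verts k G" and ?m = "card (C_max G)"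
  have finB: "finite ?B" using fin by (simp add: big_verts_def)
  have "(card ?B - ?m)\<^sup>2 \<le> card ?B * (card ?B - ?m)"
    by (simp add: power2_eq_square)
  also have "\<dots> = (\<Sum>x\<in>?B. card ?B - ?m)" by simp
  also have "\<dots> \<le> (\<Sum>x\<in>?B. card (?B - cluster G x))"
  proof (rule sum_mono)
    fix x assume "x \<in> ?B"
    then have "card (cluster G x) \<le> ?m"
      using card_le_C_max[OF fin ne] by (auto simp: big_verts_def clusters_def)
    moreover have "card ?B - card (cluster G x) \<le> card (?B - cluster G x)"
      by (rule diff_card_le_card_Diff[OF rev_finite_subset[OF fin cluster_subset_verts]])
    ultimately show "card ?B - ?m \<le> card (?B - cluster G x)" by linarith
  qed
  also have "\<dots> = card (SIGMA x:?B. ?B - cluster G x)"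
    using finB by simp
  also have "\<dots> \<le> card (separated_pairs k G)"
  proof (rule card_mono)
    show "finite (separated_pairs k G)"
      using fin by (rule finite_separated_pairs)
    show "(SIGMA x:?B. ?B - cluster G x) \<subseteq> separated_pairs k G"
      using cluster_eq cluster_refl by (fastforce simp: big_verts_def separated_pairs_def)
  qed
  finally have "real ((card ?B - ?m)\<^sup>2) \<le> real (card (separated_pairs k G))" 
    by (rule of_nat_mono)
  then have "real (card ?B - ?m) \<le> sqrt (real (card (separated_pairs k G)))"
    by (intro real_le_rsqrt) simp
  then show ?thesis using True by simp
next
  case False
  then have "real (card (big_verts k G)) \<le> real (card (C_max G))" by simp
  then show ?thesis by (rule add_increasing2[rotated]) simp
qed

text \<open>If the second component has at least \<open>k\<close> vertices, then so has the largest one, and every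
  pair between the two is separated. The product of their sizes bounds the square of the
  smaller size.\<close>

lemma card_C_second_le:
  assumes fin: "finite (verts G)"
  shows "real (card (C_second G)) \<le> real k + sqrt (real (card (separated_pairs k G)))"
proof (cases "k \<le> card (C_second G) \<and> C_second G \<noteq> {}")
  case True
  let ?M = "C_max G" and ?S = "C_second G"
  have S: "?S \<in> clusters G" "?S \<noteq> ?M" using C_second_in_clusters[OF fin] True by auto
  then have ne: "verts G \<noteq> {}" by (auto simp: clusters_def)
  note M = C_max_in_clusters[OF fin ne]
  have le: "card ?S \<le> card ?M" using card_le_C_max[OF fin ne] S by simp
  have "?M \<times> ?S \<subseteq> separated_pairs k G"
  proof clarify
    fix x y assume "x \<in> ?M" "y \<in> ?S"
    then have "x \<in> verts G" "cluster G x = ?M" "y \<in> verts G" "cluster G y = ?S"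
      using clusters_cluster_eq M S by metis+
    moreover have "x \<notin> cluster G y" using calculation S cluster_eq by metis
    ultimately show "(x, y) \<in> separated_pairs k G"
      using True le by (simp add: separated_pairs_def)
  qed
  then have "card (?M \<times> ?S) \<le> card (separated_pairs k G)"
    by (rule card_mono[OF finite_separated_pairs[OF fin]])
  moreover have "(card ?S)\<^sup>2 \<le> card (?M \<times> ?S)"
    using le by (simp add: power2_eq_square card_cartesian_product)
  ultimately have "real ((card ?S)\<^sup>2) \<le> real (card (separated_pairs k G))"
    by (intro of_nat_mono) linarith
  then have "real (card ?S) \<le> sqrt (real (card (separated_pairs k G)))"
    by (intro real_le_rsqrt) simp
  then show ?thesis by simp
next
  case False
  then have "card (C_second G) \<le> k" by auto
  then have "real (card (C_second G)) \<le> real k" by simp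
  then show ?thesis by (rule add_increasing2[rotated]) simp
qed

section \<open>Convergence in probability\<close>

text \<open>Only the covering events \<open>A n\<close> have to be measurable, because non-measurable sets have
  measure zero by convention.\<close>

lemma conv_in_probI:
  assumes P: "\<And>n. n \<ge> 1 \<Longrightarrow> prob_space (P n)"
    and A: "\<And>\<epsilon> \<eta>. 0 < \<epsilon> \<Longrightarrow> 0 < \<eta> \<Longrightarrow> \<exists>A. (\<forall>\<^sub>F n in sequentially. A n \<in> sets (P n) \<and>
      {\<omega> \<in> space (P n). \<bar>X n \<omega> - c\<bar> > \<epsilon>} \<subseteq> A n \<and> measure (P n) (A n) < \<eta>)"
  shows "conv_in_prob P X c"
  unfolding conv_in_prob_def
proof (intro allI impI)
  fix \<epsilon> :: real assume \<epsilon>: "0 < \<epsilon>"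
  show "(\<lambda>n. measure (P n) {\<omega> \<in> space (P n). \<bar>X n \<omega> - c\<bar> > \<epsilon>}) \<longlonglongrightarrow> 0"
  proof (rule tendstoI)
    fix \<eta> :: real assume "0 < \<eta>"
    then obtain A where "\<forall>\<^sub>F n in sequentially. A n \<in> sets (P n) \<and>
      {\<omega> \<in> space (P n). \<bar>X n \<omega> - c\<bar> > \<epsilon>} \<subseteq> A n \<and> measure (P n) (A n) < \<eta>"
      using A \<epsilon> by blast
    then show "\<forall>\<^sub>F n in sequentially.
        dist (measure (P n) {\<omega> \<in> space (P n). \<bar>X n \<omega> - c\<bar> > \<epsilon>}) 0 < \<eta>"
      using eventually_ge_at_top[of 1]
    proof eventually_elim
      case (elim n)
      interpret prob_space "P n" using P elim by simp
      have "prob {\<omega> \<in> space (P n). \<bar>X n \<omega> - c\<bar> > \<epsilon>} \<le> prob (A n)"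
        using elim by (intro finite_measure_mono) auto
      then show ?case using elim by simp
    qed
  qed
qed

lemma conv_in_prob_cong:
  assumes "\<And>n \<omega>. n \<ge> 1 \<Longrightarrow> \<omega> \<in> space (P n) \<Longrightarrow> X n \<omega> = Y n \<omega>"
  shows "conv_in_prob P X c \<longleftrightarrow> conv_in_prob P Y c"
proof -
  have "(\<lambda>n. measure (P n) {\<omega> \<in> space (P n). \<bar>X n \<omega> - c\<bar> > \<epsilon>}) \<longlonglongrightarrow> 0 \<longleftrightarrow>
        (\<lambda>n. measure (P n) {\<omega> \<in> space (P n). \<bar>Y n \<omega> - c\<bar> > \<epsilon>}) \<longlonglongrightarrow> 0" for \<epsilon> :: real
  proof (rule tendsto_cong)
    show "\<forall>\<^sub>F n in sequentially. measure (P n) {\<omega> \<in> space (P n). \<bar>X n \<omega> - c\<bar> > \<epsilon>} =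
        measure (P n) {\<omega> \<in> space (P n). \<bar>Y n \<omega> - c\<bar> > \<epsilon>}"
      using eventually_ge_at_top[of 1]
    proof eventually_elim
      case (elim n)
      then show ?case using assms by (intro arg_cong[of _ _ "measure (P n)"]) auto
    qed
  qed
  then show ?thesis by (simp add: conv_in_prob_def)
qed

lemma conv_in_prob_add:
  assumes P: "\<And>n. n \<ge> 1 \<Longrightarrow> prob_space (P n)"
    and m: "\<And>n. n \<ge> 1 \<Longrightarrow> X n \<in> borel_measurable (P n)" "\<And>n. n \<ge> 1 \<Longrightarrow> Y n \<in> borel_measurable (P n)"
    and X: "conv_in_prob P X a" and Y: "conv_in_prob P Y b"
  shows "conv_in_prob P (\<lambda>n \<omega>. X n \<omega> + Y n \<omega>) (a + b)"
proof (rule conv_in_probI[OF P])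
  fix \<epsilon> \<eta> :: real assume \<epsilon>: "0 < \<epsilon>" and \<eta>: "0 < \<eta>"
  let ?A = "\<lambda>n. {\<omega> \<in> space (P n). \<bar>X n \<omega> - a\<bar> > \<epsilon> / 2}"
  let ?B = "\<lambda>n. {\<omega> \<in> space (P n). \<bar>Y n \<omega> - b\<bar> > \<epsilon> / 2}"
  have A: "(\<lambda>n. measure (P n) (?A n)) \<longlonglongrightarrow> 0"
    using X \<epsilon> unfolding conv_in_prob_def by (meson half_gt_zero)
  have B: "(\<lambda>n. measure (P n) (?B n)) \<longlonglongrightarrow> 0"
    using Y \<epsilon> unfolding conv_in_prob_def by (meson half_gt_zero)
  have "\<forall>\<^sub>F n in sequentially. ?A n \<union> ?B n \<in> sets (P n) \<and>
      {\<omega> \<in> space (P n). \<bar>X n \<omega> + Y n \<omega> - (a + b)\<bar> > \<epsilon>} \<subseteq> ?A n \<union> ?B n \<and>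
      measure (P n) (?A n \<union> ?B n) < \<eta>"
    using order_tendstoD(2)[OF A half_gt_zero[OF \<eta>]] order_tendstoD(2)[OF B half_gt_zero[OF \<eta>]]
      eventually_ge_at_top[of 1]
  proof eventually_elim
    case (elim n)
    note [measurable] = m[OF elim(3)]
    have s: "?A n \<in> sets (P n)" "?B n \<in> sets (P n)" by measurable
    have "measure (P n) (?A n \<union> ?B n) < \<eta>"
      using measure_Un_le[OF s] elim by linarith
    moreover have "{\<omega> \<in> space (P n). \<bar>X n \<omega> + Y n \<omega> - (a + b)\<bar> > \<epsilon>} \<subseteq> ?A n \<union> ?B n"
    proof
      fix \<omega> assume "\<omega> \<in> {\<omega> \<in> space (P n). \<bar>X n \<omega> + Y n \<omega> - (a + b)\<bar> > \<epsilon>}"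
      then have "\<omega> \<in> space (P n)" "\<bar>X n \<omega> + Y n \<omega> - (a + b)\<bar> > \<epsilon>" by simp_all
      moreover from this(2) have "\<bar>X n \<omega> - a\<bar> > \<epsilon> / 2 \<or> \<bar>Y n \<omega> - b\<bar> > \<epsilon> / 2" by linarith
      ultimately show "\<omega> \<in> ?A n \<union> ?B n" by blast
    qed
    ultimately show ?case using s by blast
  qed
  then show "\<exists>A. \<forall>\<^sub>F n in sequentially. A n \<in> sets (P n) \<and>
      {\<omega> \<in> space (P n). \<bar>X n \<omega> + Y n \<omega> - (a + b)\<bar> > \<epsilon>} \<subseteq> A n \<and> measure (P n) (A n) < \<eta>"
    by (rule exI[where x = "\<lambda>n. ?A n \<union> ?B n"])
qed

lemma conv_in_prob_const: "conv_in_prob P (\<lambda>n \<omega>. c) c"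
  by (simp add: conv_in_prob_def)

lemma conv_in_prob_sum:
  assumes P: "\<And>n. n \<ge> 1 \<Longrightarrow> prob_space (P n)" and "finite I"
    and "\<And>i n. i \<in> I \<Longrightarrow> n \<ge> 1 \<Longrightarrow> X i n \<in> borel_measurable (P n)"
    and "\<And>i. i \<in> I \<Longrightarrow> conv_in_prob P (X i) (c i)"
  shows "conv_in_prob P (\<lambda>n \<omega>. \<Sum>i\<in>I. X i n \<omega>) (\<Sum>i\<in>I. c i)"
  using assms(2-4)
proof (induction I rule: finite_induct)
  case empty
  then show ?case by (simp add: conv_in_prob_const)
next
  case (insert i I)
  have "conv_in_prob P (\<lambda>n \<omega>. X i n \<omega> + (\<Sum>i\<in>I. X i n \<omega>)) (c i + (\<Sum>i\<in>I. c i))"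
    using insert by (intro conv_in_prob_add[OF P] borel_measurable_sum) auto
  then show ?case using insert by simp
qed

lemma conv_in_prob_one_minus:
  assumes "conv_in_prob P X c"
  shows "conv_in_prob P (\<lambda>n \<omega>. 1 - X n \<omega>) (1 - c)"
proof -
  have "\<bar>1 - x - (1 - c)\<bar> = \<bar>x - c\<bar>" for x :: real by linarith
  then show ?thesis using assms unfolding conv_in_prob_def by simp
qed

section \<open>The giant component\<close>

text \<open>On a random graph with values in a discrete space, every graph functional is a random
  variable.\<close>

lemma borel_measurable_graph_function:
  assumes "G \<in> M \<rightarrow>\<^sub>M count_space \<G>"
  shows "(\<lambda>\<omega>. f (G \<omega>) :: real) \<in> borel_measurable M"
  using measurable_compose[OF assms, of f borel] by simp

text \<open>Lying in a component with fewer than \<open>k\<close> vertices is the same as having one of finitely many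
  balls of radius \<open>k\<close>. The proportion of such vertices is thus a finite sum of the proportions
  that local convergence controls.\<close>

lemma big_verts_conv_in_prob:
  fixes P :: "nat \<Rightarrow> 'w measure" and G :: "nat \<Rightarrow> 'w \<Rightarrow> 'a sgraph"
  assumes P: "\<And>n. n \<ge> 1 \<Longrightarrow> prob_space (P n)"
    and G: "\<And>n. n \<ge> 1 \<Longrightarrow> G n \<in> P n \<rightarrow>\<^sub>M count_space (graphs_of_size n)"
    and \<mu>: "prob_space \<mu>" "sets \<mu> = sets G_star_space"
    and loc: "local_conv_in_prob P G \<mu>"
  shows "conv_in_prob P (\<lambda>n \<omega>. real (card (big_verts k (G n \<omega>))) / real n)
           (1 - measure \<mu> (small_classes k))"
proof -
  let ?X = "\<lambda>H n \<omega>. 1 / real (card (verts (G n \<omega>))) *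
             (\<Sum>v\<in>verts (G n \<omega>). of_bool (iso_class (root_ball k (G n \<omega>, v)) = H))"
  have "conv_in_prob P (\<lambda>n \<omega>. \<Sum>H\<in>small_classes k. ?X H n \<omega>)
          (\<Sum>H\<in>small_classes k. measure \<mu> (ball_event k H))"
  proof (rule conv_in_prob_sum[OF P finite_small_classes])
    fix H n assume "H \<in> small_classes k"
    show "?X H n \<in> borel_measurable (P n)" if "n \<ge> 1"
      by (rule borel_measurable_graph_function[OF G[OF that]])
    show "conv_in_prob P (?X H) (measure \<mu> (ball_event k H))"
      using loc small_classes_subset_G_star[of k] \<open>H \<in> small_classes k\<close>
      by (auto simp: local_conv_in_prob_def)
  qed
  then have "conv_in_prob P (\<lambda>n \<omega>. 1 - (\<Sum>H\<in>small_classes k. ?X H n \<omega>))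
          (1 - measure \<mu> (small_classes k))"
    unfolding measure_small_classes[OF \<mu>] by (rule conv_in_prob_one_minus)
  moreover have "1 - (\<Sum>H\<in>small_classes k. ?X H n \<omega>) = real (card (big_verts k (G n \<omega>))) / real n"
    if n: "n \<ge> 1" and \<omega>: "\<omega> \<in> space (P n)" for n \<omega>
  proof -
    let ?g = "G n \<omega>"
    have g: "simple_graph ?g" "finite (verts ?g)" "card (verts ?g) = n"
      using measurable_space[OF G[OF n] \<omega>] by (auto simp: graphs_of_size_def)
    have lf: "locally_finite ?g"
      unfolding locally_finite_def
    proof
      fix v
      have "{u. adj ?g v u} \<subseteq> verts ?g" using adj_in_verts(2)[OF g(1)] by blast
      then show "finite {u. adj ?g v u}" using g(2) by (rule finite_subset)
    qed
    have "(\<Sum>H\<in>small_classes k. of_bool (iso_class (root_ball k (?g, v)) = H))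
            = (of_bool (card (cluster ?g v) < k) :: real)" if v: "v \<in> verts ?g" for v
    proof -
      have "(\<Sum>H\<in>small_classes k. of_bool (iso_class (root_ball k (?g, v)) = H))
          = (of_bool (iso_class (root_ball k (?g, v)) \<in> small_classes k) :: real)"
        using finite_small_classes[of k] by (simp add: of_bool_def sum.delta)
      moreover have "finite (cluster ?g v)"
        using g(2) cluster_subset_verts by (rule rev_finite_subset)
      ultimately show ?thesis
        using root_ball_in_small_classes_iff[OF g(1) lf v] by simp
    qed
    then have "(\<Sum>H\<in>small_classes k. ?X H n \<omega>)
        = 1 / real n * (\<Sum>v\<in>verts ?g. of_bool (card (cluster ?g v) < k))"
      unfolding g(3) sum_distrib_left[symmetric] by (subst sum.swap) simp
    also have "(\<Sum>v\<in>verts ?g. of_bool (card (cluster ?g v) < k)) = real (card (verts ?g - big_verts k ?g))"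
    proof -
      have "verts ?g \<inter> {v. card (cluster ?g v) < k} = verts ?g - big_verts k ?g"
        by (auto simp: big_verts_def)
      then show ?thesis using g(2) by (simp add: of_bool_def sum.If_cases)
    qed
    also have "card (verts ?g - big_verts k ?g) = n - card (big_verts k ?g)"
      using g by (subst card_Diff_subset) (auto simp: big_verts_def)
    also have "real \<dots> = real n - real (card (big_verts k ?g))"
      using card_mono[of "verts ?g" "big_verts k ?g"] g by (intro of_nat_diff) (auto simp: big_verts_def)
    finally show ?thesis using n by (simp add: field_simps)
  qed
  ultimately show ?thesis
    using conv_in_prob_cong[of P "\<lambda>n \<omega>. 1 - (\<Sum>H\<in>small_classes k. ?X H n \<omega>)"
      "\<lambda>n \<omega>. real (card (big_verts k (G n \<omega>))) / real n"] by blast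
qed

text \<open>The number of pairs never exceeds \<open>n\<^sup>2\<close>, which makes it integrable; Markov's inequality is
  then applied at the level \<open>(a * n)\<^sup>2\<close>.\<close>

lemma separated_pairs_Markov:
  assumes "prob_space M" and G: "G \<in> M \<rightarrow>\<^sub>M count_space (graphs_of_size n)"
    and n: "n \<ge> 1" and a: "a > 0"
  shows "measure M {\<omega> \<in> space M. sqrt (real (card (separated_pairs k (G \<omega>)))) > a * real n}
     \<le> 1 / (real n)\<^sup>2 * (\<integral>\<omega>. real (card (separated_pairs k (G \<omega>))) \<partial>M) / a\<^sup>2"
proof -
  interpret prob_space M by fact
  let ?N = "\<lambda>\<omega>. real (card (separated_pairs k (G \<omega>)))"
  have m[measurable]: "?N \<in> borel_measurable M"
    by (rule borel_measurable_graph_function[OF G])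
  have "card (separated_pairs k (G \<omega>)) \<le> n * n" if "\<omega> \<in> space M" for \<omega>
    using measurable_space[OF G that] card_mono[OF _ separated_pairs_subset[of k "G \<omega>"]]
    by (auto simp: graphs_of_size_def card_cartesian_product)
  then have "AE \<omega> in M. norm (?N \<omega>) \<le> real (n * n)"
    by (intro AE_I2) (simp del: of_nat_mult)
  then have int: "integrable M ?N" by (intro integrable_const_bound[OF _ m])
  have pos: "0 < (a * real n)\<^sup>2" using n a by simp
  have "prob {\<omega> \<in> space M. sqrt (?N \<omega>) > a * real n} \<le> prob {\<omega> \<in> space M. ?N \<omega> \<ge> (a * real n)\<^sup>2}"
  proof (rule finite_measure_mono)
    show "{\<omega> \<in> space M. sqrt (?N \<omega>) > a * real n} \<subseteq> {\<omega> \<in> space M. ?N \<omega> \<ge> (a * real n)\<^sup>2}"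
      using a by (auto intro!: less_imp_le[THEN sqrt_ge_absD])
  qed measurable
  also have "\<dots> \<le> (\<integral>\<omega>. ?N \<omega> \<partial>M) / (a * real n)\<^sup>2"
    using integral_Markov_inequality_measure[OF int, of "{}"  "(a * real n)\<^sup>2"] pos by simp
  finally show ?thesis by (simp add: power_mult_distrib field_simps)
qed

theorem theorem2p2:
  fixes P :: "nat \<Rightarrow> 'w measure"
    and G :: "nat \<Rightarrow> 'w \<Rightarrow> 'a sgraph"
    and \<mu> :: "nat rgraph set measure"
  assumes "\<And>n. n \<ge> 1 \<Longrightarrow> prob_space (P n)"
    and "\<And>n. n \<ge> 1 \<Longrightarrow> G n \<in> P n \<rightarrow>\<^sub>M count_space (graphs_of_size n)"
    and "prob_space \<mu>" and "sets \<mu> = sets G_star_space"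
    and "local_conv_in_prob P G \<mu>"
    and "(\<lambda>k. limsup (\<lambda>n. ereal (1 / (real n)\<^sup>2 *
            (\<integral>\<omega>. real (card (separated_pairs k (G n \<omega>))) \<partial>P n)))) \<longlonglongrightarrow> 0"
  shows "conv_in_prob P (\<lambda>n \<omega>. real (card (C_max (G n \<omega>))) / real n) (measure \<mu> infinite_event)
       \<and> conv_in_prob P (\<lambda>n \<omega>. real (card (C_second (G n \<omega>))) / real n) 0"
proof -
  note P = assms(1) and G = assms(2) and \<mu> = assms(3,4)
  define \<zeta> where "\<zeta> = measure \<mu> infinite_event"
  define \<zeta>' where "\<zeta>' k = 1 - measure \<mu> (small_classes k)" for k
  define E where "E k n = 1 / (real n)\<^sup>2 *
      (\<integral>\<omega>. real (card (separated_pairs k (G n \<omega>))) \<partial>P n)" for k n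
  let ?S = "\<lambda>k n \<omega>. real (card (big_verts k (G n \<omega>)))"
  let ?N = "\<lambda>k n \<omega>. sqrt (real (card (separated_pairs k (G n \<omega>))))"
  have \<zeta>': "\<zeta>' \<longlonglongrightarrow> \<zeta>"
    using tendsto_diff[OF tendsto_const measure_small_classes_tendsto[OF \<mu>], of 1]
    by (simp add: \<zeta>_def \<zeta>'_def[abs_def])
  have key: "\<exists>A. \<forall>\<^sub>F n in sequentially. A n \<in> sets (P n) \<and>
      {\<omega> \<in> space (P n). \<bar>real (card (C_max (G n \<omega>))) / real n - \<zeta>\<bar> > \<epsilon>} \<subseteq> A n \<and>
      {\<omega> \<in> space (P n). \<bar>real (card (C_second (G n \<omega>))) / real n - 0\<bar> > \<epsilon>} \<subseteq> A n \<and>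
      measure (P n) (A n) < \<eta>" if \<epsilon>: "0 < \<epsilon>" and \<eta>: "0 < \<eta>" for \<epsilon> \<eta> :: real
  proof -
    \<comment> \<open>At most four errors add up: \<open>k / n\<close>, \<open>sqrt N / n\<close>, \<open>\<bar>S / n - \<zeta>' k\<bar>\<close> and \<open>\<bar>\<zeta>' k - \<zeta>\<bar>\<close>.\<close>
    define \<delta> where "\<delta> = \<epsilon> / 4"
    have \<delta>: "\<delta> > 0" using \<epsilon> by (simp add: \<delta>_def)
    \<comment> \<open>The level \<open>k\<close> is fixed before \<open>n\<close> grows: it makes both the truncation of \<open>\<zeta>\<close> and the
      asymptotic density of separated pairs small.\<close>
    have "0 < ereal (\<eta> / 2 * \<delta>\<^sup>2)" using \<delta> \<eta> by simp
    then have "\<forall>\<^sub>F k in sequentially. limsup (\<lambda>n. ereal (E k n)) < ereal (\<eta> / 2 * \<delta>\<^sup>2)"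
      using order_tendstoD(2)[OF assms(6)] by (simp add: E_def)
    moreover have "\<forall>\<^sub>F k in sequentially. dist (\<zeta>' k) \<zeta> < \<delta>"
      using \<zeta>' \<delta> by (rule tendstoD)
    ultimately have "\<forall>\<^sub>F k in sequentially. limsup (\<lambda>n. ereal (E k n)) < ereal (\<eta> / 2 * \<delta>\<^sup>2) \<and>
        dist (\<zeta>' k) \<zeta> < \<delta>"
      by (rule eventually_conj)
    then obtain k where k: "limsup (\<lambda>n. ereal (E k n)) < ereal (\<eta> / 2 * \<delta>\<^sup>2)" "dist (\<zeta>' k) \<zeta> < \<delta>"
      using eventually_happens'[OF sequentially_bot] by blast
    define A where "A n = {\<omega> \<in> space (P n). \<bar>?S k n \<omega> / real n - \<zeta>' k\<bar> > \<delta>}" for n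
    define B where "B n = {\<omega> \<in> space (P n). ?N k n \<omega> > \<delta> * real n}" for n
    have "(\<lambda>n. measure (P n) (A n)) \<longlonglongrightarrow> 0"
      using big_verts_conv_in_prob[OF P G \<mu> assms(5), of k] \<delta>
      by (simp add: conv_in_prob_def A_def \<zeta>'_def)
    then have evA: "\<forall>\<^sub>F n in sequentially. measure (P n) (A n) < \<eta> / 2"
      using order_tendstoD(2) \<eta> half_gt_zero by blast
    have evE: "\<forall>\<^sub>F n in sequentially. E k n < \<eta> / 2 * \<delta>\<^sup>2"
      using Limsup_lessD[OF k(1)] by simp
    have "\<forall>\<^sub>F n in sequentially. real k / \<delta> < real n"
      by (rule eventually_compose_filterlim[OF eventually_gt_at_top filterlim_real_sequentially])
    with evA evE have "\<forall>\<^sub>F n in sequentially. A n \<union> B n \<in> sets (P n) \<and>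
      {\<omega> \<in> space (P n). \<bar>real (card (C_max (G n \<omega>))) / real n - \<zeta>\<bar> > \<epsilon>} \<subseteq> A n \<union> B n \<and>
      {\<omega> \<in> space (P n). \<bar>real (card (C_second (G n \<omega>))) / real n - 0\<bar> > \<epsilon>} \<subseteq> A n \<union> B n \<and>
      measure (P n) (A n \<union> B n) < \<eta>"
      using eventually_ge_at_top[of 1]
    proof eventually_elim
      case (elim n)
      have [measurable]: "?S k n \<in> borel_measurable (P n)" "?N k n \<in> borel_measurable (P n)"
        by (rule borel_measurable_graph_function[OF G[OF elim(4)]])+
      have s: "A n \<in> sets (P n)" "B n \<in> sets (P n)"
        unfolding A_def B_def by measurable
      have "measure (P n) (B n) \<le> E k n / \<delta>\<^sup>2"
        unfolding B_def E_def using separated_pairs_Markov[OF P G _ \<delta>] elim(4) by blast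
      also have "\<dots> < \<eta> / 2" using elim(2) \<delta> by (simp add: pos_divide_less_eq)
      finally have m: "measure (P n) (A n \<union> B n) < \<eta>"
        using measure_Un_le[OF s] elim(1) by linarith
      have kn: "real k / real n < \<delta>"
        using elim(3,4) \<delta> by (simp add: field_simps)
      have bounds: "\<bar>real (card (C_max (G n \<omega>))) / real n - \<zeta>\<bar> \<le> \<epsilon> \<and>
          \<bar>real (card (C_second (G n \<omega>))) / real n - 0\<bar> \<le> \<epsilon>"
        if \<omega>: "\<omega> \<in> space (P n)" "\<omega> \<notin> A n" "\<omega> \<notin> B n" for \<omega>
      proof -
        let ?M = "real (card (C_max (G n \<omega>)))" and ?C = "real (card (C_second (G n \<omega>)))"
        have g: "finite (verts (G n \<omega>))" "verts (G n \<omega>) \<noteq> {}"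
          using measurable_space[OF G[OF elim(4)] \<omega>(1)] elim(4) by (auto simp: graphs_of_size_def)
        have n: "real n > 0" using elim(4) by simp
        have N: "?N k n \<omega> / real n \<le> \<delta>" using \<omega> n by (simp add: B_def pos_divide_le_eq)
        have S: "\<bar>?S k n \<omega> / real n - \<zeta>' k\<bar> \<le> \<delta>" using \<omega> by (simp add: A_def)
        have "?M \<le> real k + ?S k n \<omega>"
          using card_C_max_le[OF g, of k] by (metis of_nat_add of_nat_le_iff)
        then have "?M / real n \<le> real k / real n + ?S k n \<omega> / real n"
          unfolding add_divide_distrib[symmetric] by (rule divide_right_mono) simp
        moreover have "?S k n \<omega> / real n \<le> ?M / real n + ?N k n \<omega> / real n"
          unfolding add_divide_distrib[symmetric]
          by (rule divide_right_mono[OF card_big_verts_le[OF g]]) simp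
        moreover have "?C / real n \<le> real k / real n + ?N k n \<omega> / real n"
          unfolding add_divide_distrib[symmetric]
          by (rule divide_right_mono[OF card_C_second_le[OF g(1)]]) simp
        moreover have "?C / real n \<ge> 0" by simp
        moreover have "\<bar>\<zeta>' k - \<zeta>\<bar> < \<delta>" using k(2) by (simp add: dist_real_def)
        ultimately show ?thesis using N S kn \<delta> unfolding \<delta>_def by linarith
      qed
      have "{\<omega> \<in> space (P n). \<bar>real (card (C_max (G n \<omega>))) / real n - \<zeta>\<bar> > \<epsilon>} \<subseteq> A n \<union> B n"
        "{\<omega> \<in> space (P n). \<bar>real (card (C_second (G n \<omega>))) / real n - 0\<bar> > \<epsilon>} \<subseteq> A n \<union> B n"
        using bounds by fastforce+
      then show ?case using s m by blast
    qed
    then show ?thesis by (rule exI[where x = "\<lambda>n. A n \<union> B n"])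
  qed
  have "conv_in_prob P (\<lambda>n \<omega>. real (card (C_max (G n \<omega>))) / real n) \<zeta>"
  proof (rule conv_in_probI[OF P])
    fix \<epsilon> \<eta> :: real assume "0 < \<epsilon>" "0 < \<eta>"
    from key[OF this] show "\<exists>A. \<forall>\<^sub>F n in sequentially. A n \<in> sets (P n) \<and>
      {\<omega> \<in> space (P n). \<bar>real (card (C_max (G n \<omega>))) / real n - \<zeta>\<bar> > \<epsilon>} \<subseteq> A n \<and>
      measure (P n) (A n) < \<eta>"
      by (elim ex_forward eventually_mono) blast
  qed
  moreover have "conv_in_prob P (\<lambda>n \<omega>. real (card (C_second (G n \<omega>))) / real n) 0"
  proof (rule conv_in_probI[OF P])
    fix \<epsilon> \<eta> :: real assume "0 < \<epsilon>" "0 < \<eta>"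
    from key[OF this] show "\<exists>A. \<forall>\<^sub>F n in sequentially. A n \<in> sets (P n) \<and>
      {\<omega> \<in> space (P n). \<bar>real (card (C_second (G n \<omega>))) / real n - 0\<bar> > \<epsilon>} \<subseteq> A n \<and>
      measure (P n) (A n) < \<eta>"
      by (elim ex_forward eventually_mono) blast
  qed
  ultimately show ?thesis by (simp add: \<zeta>_def)
qed

end
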